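(* For any choice of the integer sequences $\mathbf a=(a_1,a_2,\dots)$ and $\mathbf b=(b_1,b_2,\dots)$ (infinite sequences of positive integers) with $b_i\ge3$ for all $i$, the bubble group $\Gamma_{\mathbf a,\mathbf b}$ has exponential volume growth.
   Context: Let $\mathbf a=(a_1,a_2,\dots)$, $\mathbf b=(b_1,b_2,\dots)$ be integer sequences, $a_i\ge1$, $b_i\ge 2$. The bubble graph $X_{\mathbf a,\mathbf b}$ has as vertices the pairs $(w,u)$ where $w=w_1\cdots w_k$ is a finite (possibly empty) word with $w_i\in\{1,\dots,b_i-1\}$, $|w|=k\ge0$, and $u\in\{0,\dots,2a_{k+1}-1\}$. For fixed $w$ with $|w|=k$, the vertices $(w,u)$ form an oriented cycle of length $2a_{k+1}$ (a bubble). For each word $w'$ with $|w'|=k-1$, $k\ge1$, the vertices $(w',a_k),(w'1,0),\dots,(w'(b_k-1),0)$, in this cyclic order, form an oriented cycle of length $b_k$ (a branching cycle). The permutation $\alpha$ rotates every bubble by one step, $(w,u)\mapsto(w,u+1\bmod 2a_{|w|+1})$; the permutation $\beta$ rotates every branching cycle by one step and fixes every vertex not on a branching cycle. The bubble group $\Gamma_{\mathbf a,\mathbf b}$ is the group of permutations of the vertex set of $X_{\mathbf a,\mathbf b}$ generated by $\alpha$ and $\beta$. *)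

theory Defs
  imports Complex_Main "HOL-Algebra.Bij" "HOL-Algebra.Generated_Groups"
begin

section \<open>Growth of groups\<close>

definition word_ball :: "('g, 'm) monoid_scheme \<Rightarrow> 'g set \<Rightarrow> nat \<Rightarrow> 'g set" where
  "word_ball G S n = {foldr (mult G) xs (one G) | xs. set xs \<subseteq> S \<union> m_inv G ` S \<and> length xs \<le> n}"

definition finite_generating_set :: "('g, 'm) monoid_scheme \<Rightarrow> 'g set \<Rightarrow> bool" where
  "finite_generating_set G S \<longleftrightarrow> finite S \<and> S \<subseteq> carrier G \<and> generate G S = carrier G"

text \<open>Whether the growth is exponential does not depend on the finite generating set; the
  definition asks for it for all of them, and for at least one to exist.\<close>

definition exponential_growth :: "('g, 'm) monoid_scheme \<Rightarrow> bool" where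
  "exponential_growth G \<longleftrightarrow>
     (\<exists>S. finite_generating_set G S) \<and>
     (\<forall>S. finite_generating_set G S \<longrightarrow>
        (\<exists>c::real. c > 1 \<and> (\<forall>n. c ^ n \<le> real (card (word_ball G S n)))))"

section \<open>Bubble groups\<close>

text \<open>Sequences are indexed from 0: \<open>a i\<close> and \<open>b i\<close> stand for $a_{i+1}$ and $b_{i+1}$. So, for a
  word \<open>w\<close>, the bubble at \<open>w\<close> has length \<open>2 * a (length w)\<close>, and the branching cycle through
  \<open>(w, a (length w))\<close> has length \<open>b (length w)\<close>.\<close>

type_synonym vertex = "nat list \<times> nat"

definition bubble_words :: "(nat \<Rightarrow> nat) \<Rightarrow> nat list set" where
  "bubble_words b = {w. \<forall>i<length w. w ! i \<in> {1..<b i}}"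

definition bubble_vertices :: "(nat \<Rightarrow> nat) \<Rightarrow> (nat \<Rightarrow> nat) \<Rightarrow> vertex set" where
  "bubble_vertices a b = {(w, u). w \<in> bubble_words b \<and> u < 2 * a (length w)}"

definition branching_cycle :: "(nat \<Rightarrow> nat) \<Rightarrow> (nat \<Rightarrow> nat) \<Rightarrow> nat list \<Rightarrow> vertex list" where
  "branching_cycle a b w = (w, a (length w)) # map (\<lambda>j. (w @ [j], 0)) [1..<b (length w)]"

definition bubble_alpha :: "(nat \<Rightarrow> nat) \<Rightarrow> (nat \<Rightarrow> nat) \<Rightarrow> vertex \<Rightarrow> vertex" where
  "bubble_alpha a b =
     (\<lambda>(w, u) \<in> bubble_vertices a b. (w, (u + 1) mod (2 * a (length w))))"

text \<open>The vertex \<open>(w, 0)\<close> with \<open>w = w' @ [j]\<close> is the one at position \<open>j\<close> of the branching cycle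
  of \<open>w'\<close>. The lemmas \<open>bubble_beta_branching_cycle\<close> and \<open>bubble_beta_fixed\<close> below relate
  \<open>bubble_beta\<close> to \<open>branching_cycle\<close>.\<close>

definition bubble_beta :: "(nat \<Rightarrow> nat) \<Rightarrow> (nat \<Rightarrow> nat) \<Rightarrow> vertex \<Rightarrow> vertex" where
  "bubble_beta a b =
     (\<lambda>(w, u) \<in> bubble_vertices a b.
        if u = a (length w) then (w @ [1], 0)
        else if u = 0 \<and> w \<noteq> [] then
          (if last w + 1 < b (length w - 1) then (butlast w @ [last w + 1], 0)
           else (butlast w, a (length w - 1)))
        else (w, u))"

text \<open>\<open>BijGroup V\<close> consists of the bijections of \<open>V\<close>, as functions that are
  \<open>undefined\<close> outside \<open>V\<close>. As \<open>subgroup_generated\<close> ignores generators outside the carrier,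
  \<open>bubble_alpha_Bij\<close> and \<open>bubble_beta_Bij\<close> below show that both generators are permutations.\<close>

definition bubble_group :: "(nat \<Rightarrow> nat) \<Rightarrow> (nat \<Rightarrow> nat) \<Rightarrow> (vertex \<Rightarrow> vertex) monoid" where
  "bubble_group a b =
     subgroup_generated (BijGroup (bubble_vertices a b)) {bubble_alpha a b, bubble_beta a b}"

lemma words_snoc: "w @ [j] \<in> bubble_words b \<longleftrightarrow> w \<in> bubble_words b \<and> 1 \<le> j \<and> j < b (length w)"
  by (auto simp: bubble_words_def nth_append less_Suc_eq)

lemma nth_branching_cycle:
  "i < b (length w) \<Longrightarrow> branching_cycle a b w ! i = (if i = 0 then (w, a (length w)) else (w @ [i], 0))"
  by (cases i) (auto simp: branching_cycle_def)

lemma set_branching_cycle: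
  "set (branching_cycle a b w) = insert (w, a (length w)) ((\<lambda>j. (w @ [j], 0)) ` {1..<b (length w)})"
  by (auto simp: branching_cycle_def)

lemma branching_cycle_vertices:
  assumes "\<And>i. a i \<ge> 1" "w \<in> bubble_words b"
  shows "set (branching_cycle a b w) \<subseteq> bubble_vertices a b"
proof -
  have "0 < a k" for k using assms(1)[of k] by simp
  then show ?thesis
    using assms(2) by (auto simp: set_branching_cycle bubble_vertices_def words_snoc)
qed

lemma bubble_beta_branching_cycle:
  assumes a: "\<And>i. a i \<ge> 1" and b: "\<And>i. b i \<ge> 2" and w: "w \<in> bubble_words b"
    and i: "i < b (length w)"
  shows "bubble_beta a b (branching_cycle a b w ! i)
           = branching_cycle a b w ! ((i + 1) mod b (length w))"
proof -
  have pos: "a k \<noteq> 0" "1 < b k" for k using a[of k] b[of k] by auto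
  have len: "length (branching_cycle a b w) = b (length w)"
    using pos(2)[of "length w"] by (simp add: branching_cycle_def)
  have V: "branching_cycle a b w ! i \<in> bubble_vertices a b"
    by (rule subsetD[OF branching_cycle_vertices[of a w b] nth_mem]) (use a w i len in auto)
  show ?thesis
  proof (cases "i = 0")
    case True
    then show ?thesis
      using V pos(2)[of "length w"] i by (simp add: nth_branching_cycle bubble_beta_def)
  next
    case i0: False
    show ?thesis
    proof (cases "i + 1 < b (length w)")
      case True
      then show ?thesis
        using V i0 i pos[of "length w"] pos(1)[of "Suc (length w)"]
        by (simp add: nth_branching_cycle bubble_beta_def)
    next
      case False
      then have "(i + 1) mod b (length w) = 0"
        using i by (cases "i + 1 = b (length w)") auto
      then show ?thesis
        using V i0 i False pos[of "length w"] pos(1)[of "Suc (length w)"]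
        by (simp add: nth_branching_cycle bubble_beta_def)
    qed
  qed
qed

lemma bubble_beta_fixed:
  assumes v: "v \<in> bubble_vertices a b"
    and "\<And>w. w \<in> bubble_words b \<Longrightarrow> v \<notin> set (branching_cycle a b w)"
  shows "bubble_beta a b v = v"
proof -
  obtain w u where vwu: "v = (w, u)" by (cases v)
  have w: "w \<in> bubble_words b" using v by (simp add: vwu bubble_vertices_def)
  have 1: "u \<noteq> a (length w)"
    using assms(2)[OF w] by (auto simp: vwu set_branching_cycle)
  have 2: False if u0: "u = 0" and ne: "w \<noteq> []"
  proof -
    obtain w' j where wj: "w = w' @ [j]" using ne by (metis append_butlast_last_id)
    show False
      using assms(2)[of w'] w u0 by (auto simp: vwu wj set_branching_cycle words_snoc)
  qed
  show ?thesis using 1 2 v by (auto simp: bubble_beta_def vwu)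
qed

lemma bubble_alpha_Bij: "bubble_alpha a b \<in> Bij (bubble_vertices a b)"
proof -
  let ?V = "bubble_vertices a b"
  let ?g = "\<lambda>(w, u). (w, (u + (2 * a (length w) - 1)) mod (2 * a (length w)))"
  have "bij_betw (bubble_alpha a b) ?V ?V"
  proof (rule bij_betw_byWitness[where f' = ?g])
    have m: "((u + 1) mod m + (m - 1)) mod m = u" "((u + (m - 1)) mod m + 1) mod m = u"
      if "u < m" for u m :: nat
    proof -
      have "((u + 1) mod m + (m - 1)) mod m = (u + 1 + (m - 1)) mod m"
        "((u + (m - 1)) mod m + 1) mod m = (u + (m - 1) + 1) mod m"
        by (rule mod_add_left_eq)+
      moreover have "u + 1 + (m - 1) = u + m" "u + (m - 1) + 1 = u + m" using that by auto
      ultimately show "((u + 1) mod m + (m - 1)) mod m = u" "((u + (m - 1)) mod m + 1) mod m = u"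
        using that by auto
    qed
    show "\<forall>x\<in>?V. ?g (bubble_alpha a b x) = x" "\<forall>x\<in>?V. bubble_alpha a b (?g x) = x"
      using m by (auto simp: bubble_alpha_def bubble_vertices_def)
    show "bubble_alpha a b ` ?V \<subseteq> ?V" "?g ` ?V \<subseteq> ?V"
      by (auto simp: bubble_alpha_def bubble_vertices_def)
  qed
  then show ?thesis by (simp add: Bij_def bubble_alpha_def)
qed

lemma bubble_beta_Bij:
  assumes a: "\<And>i. a i \<ge> 1" and b: "\<And>i. b i \<ge> 2"
  shows "bubble_beta a b \<in> Bij (bubble_vertices a b)"
proof -
  let ?V = "bubble_vertices a b"
  let ?g = "\<lambda>(w, u). if u = a (length w) then (w @ [b (length w) - 1], 0)
        else if u = 0 \<and> w \<noteq> [] then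
          (if last w > 1 then (butlast w @ [last w - 1], 0)
           else (butlast w, a (length w - 1)))
        else (w, u)"
  have pos: "0 < a k" "a k \<noteq> 0" "Suc 0 < b k" "0 < b k" "Suc 0 \<le> b k - Suc 0" for k
    using a[of k] b[of k] by auto
  have cs: "P (w, u)" if "(w, u) \<in> ?V"
    "w \<in> bubble_words b \<Longrightarrow> u = a (length w) \<Longrightarrow> P (w, a (length w))"
    "\<And>w' j. w' \<in> bubble_words b \<Longrightarrow> 1 \<le> j \<Longrightarrow> j < b (length w') \<Longrightarrow> P (w' @ [j], 0)"
    "u \<noteq> a (length w) \<Longrightarrow> u = 0 \<longrightarrow> w = [] \<Longrightarrow> P (w, u)" for P w u
  proof (cases "u = 0 \<and> w \<noteq> []")
    case True
    then obtain w' j where wj: "w = w' @ [j]" by (metis append_butlast_last_id)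
    show ?thesis using that(1) that(3)[of w' j] True
      by (auto simp: wj bubble_vertices_def words_snoc)
  qed (use that in \<open>auto simp: bubble_vertices_def\<close>)
  have B: "bubble_beta a b x \<in> ?V \<and> ?g (bubble_beta a b x) = x" if "x \<in> ?V" for x
  proof (cases x)
    case (Pair w u)
    show ?thesis unfolding Pair
      by (rule cs[where P = "\<lambda>x. bubble_beta a b x \<in> ?V \<and> ?g (bubble_beta a b x) = x"]) (use that in \<open>auto simp: pos Pair bubble_beta_def bubble_vertices_def words_snoc\<close>)
  qed
  have G: "?g x \<in> ?V \<and> bubble_beta a b (?g x) = x" if "x \<in> ?V" for x
  proof (cases x)
    case (Pair w u)
    show ?thesis unfolding Pair
      by (rule cs[where P = "\<lambda>x. ?g x \<in> ?V \<and> bubble_beta a b (?g x) = x"]) (use that in \<open>auto simp: pos Pair bubble_beta_def bubble_vertices_def words_snoc\<close>)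
  qed
  have "bij_betw (bubble_beta a b) ?V ?V"
    by (rule bij_betw_byWitness[where f' = ?g]) (use B G in blast)+
  then show ?thesis by (simp add: Bij_def bubble_beta_def)
qed

end

theory Submission
  imports Defs
begin

text \<open>Let \<open>\<alpha>\<close> and \<open>\<beta>\<close> be the two generators. Growth is submultiplicative and changes only by a
  linear rescaling of the radius under a change of generators, so it is enough to find, for
  some constant \<open>d\<close> and all \<open>k\<close>, at least \<open>2 ^ k\<close> elements that are words of length at most
  \<open>d * k\<close> in \<open>\<alpha>\<close> and \<open>\<beta>\<close> (\<open>exponential_growthI\<close>). Two different sources of such elements cover
  all sequences \<open>a\<close>.

  If \<open>a\<close> is bounded by \<open>A\<close>, already one orbit is large. From the start of a bubble, at most \<open>A\<close>
  steps of \<open>\<alpha>\<close> lead to its far point, and then \<open>\<beta>\<close> and \<open>\<beta>\<^sup>2\<close> lead to the starts of two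
  different bubbles one level further from the root, since a branching cycle has at least three
  vertices. After \<open>k\<close> rounds the root vertex can have reached \<open>2 ^ k\<close> vertices (\<open>descent_apply\<close>).

  If \<open>a\<close> is unbounded, the orbits may grow slowly, but different products of \<open>k\<close> factors \<open>\<alpha>\<close> or
  \<open>\<beta>\<alpha>\<close> are different group elements. Given two such products, cancel the factors that are applied
  first as long as they agree. Choose two neighbouring bubbles of length at least \<open>2 * k\<close> whose
  starts lie on one branching cycle, and begin one step before the start of the first of them. The
  first disagreement then decides which of the two bubbles is entered, and the remaining factors
  are too few to leave it (\<open>itinerary_distinct\<close>). Again two such starts exist because branching
  cycles have length at least three. Taking both bubbles on the same level, and not a bubble and
  its child, matters because long bubbles may occur only on isolated levels.\<close>

section \<open>Word balls and exponential growth\<close>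

lemma word_ballI:
  "set xs \<subseteq> S \<union> m_inv G ` S \<Longrightarrow> length xs \<le> n \<Longrightarrow> foldr (mult G) xs (one G) \<in> word_ball G S n"
  unfolding word_ball_def by blast

lemma word_ball_mono: "m \<le> n \<Longrightarrow> word_ball G S m \<subseteq> word_ball G S n"
  unfolding word_ball_def by force

lemma finite_word_ball:
  assumes "finite S"
  shows "finite (word_ball G S n)"
proof -
  have "finite {xs. set xs \<subseteq> S \<union> m_inv G ` S \<and> length xs \<le> n}"
    using assms by (intro finite_lists_length_le) auto
  then have "finite ((\<lambda>xs. foldr (mult G) xs (one G)) ` {xs. set xs \<subseteq> S \<union> m_inv G ` S \<and> length xs \<le> n})"
    by (rule finite_imageI)
  then show ?thesis
    by (rule finite_subset[rotated]) (auto simp: word_ball_def)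
qed

context group
begin

lemma foldr_mult_closed: "set xs \<subseteq> carrier G \<Longrightarrow> foldr (mult G) xs \<one> \<in> carrier G"
  by (induction xs) auto

lemma foldr_mult_append:
  "set xs \<subseteq> carrier G \<Longrightarrow> set ys \<subseteq> carrier G \<Longrightarrow>
    foldr (mult G) (xs @ ys) \<one> = foldr (mult G) xs \<one> \<otimes> foldr (mult G) ys \<one>"
  by (induction xs) (auto simp: m_assoc foldr_mult_closed simp del: foldr_append)

lemma one_in_word_ball: "\<one> \<in> word_ball G S n"
  using word_ballI[of "[]" S G n] by simp

lemma generator_in_word_ball: "S \<subseteq> carrier G \<Longrightarrow> s \<in> S \<union> m_inv G ` S \<Longrightarrow> 1 \<le> n \<Longrightarrow> s \<in> word_ball G S n"
  using word_ballI[of "[s]" S G n] by auto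

lemma word_ball_add:
  assumes "S \<subseteq> carrier G"
  shows "word_ball G S (m + n) = (\<lambda>(x, y). x \<otimes> y) ` (word_ball G S m \<times> word_ball G S n)"
proof (intro equalityI subsetI)
  let ?A = "S \<union> m_inv G ` S"
  have A: "?A \<subseteq> carrier G" using assms by auto
  fix z assume "z \<in> word_ball G S (m + n)"
  then obtain xs where xs: "set xs \<subseteq> ?A" "length xs \<le> m + n" "z = foldr (mult G) xs \<one>"
    unfolding word_ball_def by blast
  have sub: "set (take m xs) \<subseteq> ?A" "set (drop m xs) \<subseteq> ?A"
    using xs(1) set_take_subset[of m xs] set_drop_subset[of m xs] by (simp_all only: subset_trans)
  have "z = foldr (mult G) (take m xs) \<one> \<otimes> foldr (mult G) (drop m xs) \<one>"
    using foldr_mult_append[OF subset_trans[OF sub(1) A] subset_trans[OF sub(2) A]] xs(3)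
    by (simp only: append_take_drop_id)
  moreover have "foldr (mult G) (take m xs) \<one> \<in> word_ball G S m"
    by (rule word_ballI) (use sub in auto)
  moreover have "foldr (mult G) (drop m xs) \<one> \<in> word_ball G S n"
    by (rule word_ballI) (use sub xs(2) in auto)
  ultimately show "z \<in> (\<lambda>(x, y). x \<otimes> y) ` (word_ball G S m \<times> word_ball G S n)" by auto
next
  let ?A = "S \<union> m_inv G ` S"
  have A: "?A \<subseteq> carrier G" using assms by auto
  fix z assume "z \<in> (\<lambda>(x, y). x \<otimes> y) ` (word_ball G S m \<times> word_ball G S n)"
  then obtain xs ys where xs: "set xs \<subseteq> ?A" "length xs \<le> m" "set ys \<subseteq> ?A" "length ys \<le> n"
    and z: "z = foldr (mult G) xs \<one> \<otimes> foldr (mult G) ys \<one>"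
    unfolding word_ball_def by auto
  have "z = foldr (mult G) (xs @ ys) \<one>"
    using foldr_mult_append[OF subset_trans[OF xs(1) A] subset_trans[OF xs(3) A]] z by simp
  then show "z \<in> word_ball G S (m + n)"
    using word_ballI[of "xs @ ys" S G "m + n"] xs by simp
qed

lemma word_ball_mult:
  "S \<subseteq> carrier G \<Longrightarrow> x \<in> word_ball G S m \<Longrightarrow> y \<in> word_ball G S n \<Longrightarrow> x \<otimes> y \<in> word_ball G S (m + n)"
  by (auto simp: word_ball_add)

lemma word_ball_pow:
  assumes "S \<subseteq> carrier G" "x \<in> word_ball G S m"
  shows "x [^] n \<in> word_ball G S (n * m)"
proof (induction n)
  case (Suc n)
  then show ?case using word_ball_mult[OF assms(1) Suc assms(2)] by (simp add: add.commute)
qed (simp add: one_in_word_ball)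

lemma word_ball_inv:
  assumes S: "S \<subseteq> carrier G" and "x \<in> word_ball G S n"
  shows "inv x \<in> word_ball G S n"
proof -
  let ?A = "S \<union> m_inv G ` S"
  have A: "?A \<subseteq> carrier G" using S by auto
  have *: "inv (foldr (mult G) xs \<one>) \<in> word_ball G S (length xs)" if "set xs \<subseteq> ?A" for xs
    using that
  proof (induction xs)
    case (Cons y ys)
    have "y \<in> carrier G" "foldr (mult G) ys \<one> \<in> carrier G"
      using Cons.prems A foldr_mult_closed[of ys] by auto
    moreover have "inv y \<in> word_ball G S 1"
      using Cons.prems S by (intro generator_in_word_ball) auto
    ultimately show ?case
      using word_ball_mult[OF S, of "inv (foldr (mult G) ys \<one>)" "length ys" "inv y" 1] Cons
      by (simp add: inv_mult_group)
  qed (simp add: one_in_word_ball)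
  show ?thesis
    using assms(2) * word_ball_mono[of _ n G S] unfolding word_ball_def[of G S n] by blast
qed

lemma generate_imp_word_ball:
  assumes S: "S \<subseteq> carrier G" and "x \<in> generate G S"
  shows "\<exists>n. x \<in> word_ball G S n"
  using assms(2)
proof induction
  case one
  show ?case using one_in_word_ball by blast
next
  case (incl h)
  then show ?case using generator_in_word_ball[OF S, of h 1] by auto
next
  case (inv h)
  then show ?case using generator_in_word_ball[OF S, of "inv h" 1] by auto
next
  case (eng h1 h2)
  then show ?case using word_ball_mult[OF S] by blast
qed

lemma card_word_ball_mult_le:
  assumes "S \<subseteq> carrier G" "finite S"
  shows "card (word_ball G S (d * n)) \<le> card (word_ball G S n) ^ d"
proof (induction d)
  case 0
  then show ?case by (auto simp: word_ball_def)
next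
  case (Suc d)
  have "card (word_ball G S (Suc d * n))
      = card ((\<lambda>(x, y). x \<otimes> y) ` (word_ball G S n \<times> word_ball G S (d * n)))"
    using word_ball_add[OF assms(1), of n "d * n"] by simp
  also have "\<dots> \<le> card (word_ball G S n \<times> word_ball G S (d * n))"
    by (intro card_image_le) (simp add: finite_word_ball assms)
  also have "\<dots> \<le> card (word_ball G S n) ^ Suc d"
    using Suc by (simp add: card_cartesian_product)
  finally show ?case .
qed

lemma word_ball_change_generators:
  assumes S: "S \<subseteq> carrier G" and T: "T \<subseteq> word_ball G S L"
  shows "word_ball G T n \<subseteq> word_ball G S (L * n)"
proof -
  have *: "foldr (mult G) xs \<one> \<in> word_ball G S (L * length xs)" if "set xs \<subseteq> T \<union> m_inv G ` T" for xs
    using that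
  proof (induction xs)
    case (Cons y ys)
    have "y \<in> word_ball G S L" using Cons.prems T word_ball_inv[OF S] by auto
    then show ?case using Cons word_ball_mult[OF S] by simp
  qed (simp add: one_in_word_ball)
  show ?thesis
  proof
    fix x assume "x \<in> word_ball G T n"
    then obtain xs where "set xs \<subseteq> T \<union> m_inv G ` T" "length xs \<le> n" "x = foldr (mult G) xs \<one>"
      unfolding word_ball_def by blast
    then show "x \<in> word_ball G S (L * n)"
      using * word_ball_mono[of "L * length xs" "L * n" G S] by auto
  qed
qed

text \<open>A set \<open>S\<close> of generators expresses \<open>T\<close> by words of some length \<open>L\<close>, whence \<open>2 ^ n\<close> elements of
  \<open>S\<close>-length at most \<open>L * d * n\<close>. Submultiplicativity turns this into the bound \<open>2 powr (n / (L * d))\<close>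
  at every radius \<open>n\<close>, including those below \<open>L * d\<close>.\<close>

lemma exponential_growthI:
  assumes T: "finite_generating_set G T"
    and card: "\<And>k. 2 ^ k \<le> card (word_ball G T (d * k))"
  shows "exponential_growth G"
  unfolding exponential_growth_def
proof (intro conjI allI impI)
  show "\<exists>S. finite_generating_set G S" using T by blast
next
  fix S assume "finite_generating_set G S"
  then have S: "finite S" "S \<subseteq> carrier G" "generate G S = carrier G"
    by (auto simp: finite_generating_set_def)
  have T': "finite T" "T \<subseteq> carrier G" using T by (auto simp: finite_generating_set_def)
  have "\<forall>t\<in>T. \<exists>n. t \<in> word_ball G S n"
    using generate_imp_word_ball[OF S(2)] S(3) T'(2) by auto
  then obtain f where f: "\<And>t. t \<in> T \<Longrightarrow> t \<in> word_ball G S (f t)" by metis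
  define L where "L = (\<Sum>t\<in>T. f t)"
  have "T \<subseteq> word_ball G S L"
  proof
    fix t assume t: "t \<in> T"
    have "f t \<le> L" unfolding L_def using T'(1) t by (intro member_le_sum) auto
    then show "t \<in> word_ball G S L" using f[OF t] word_ball_mono[of "f t" L G S] by blast
  qed
  then have sub: "word_ball G T n \<subseteq> word_ball G S (L * n)" for n
    by (rule word_ball_change_generators[OF S(2)])
  define D where "D = L * d"
  have le: "2 ^ n \<le> card (word_ball G S n) ^ D" for n
  proof -
    have "(2::nat) ^ n \<le> card (word_ball G T (d * n))" by (rule card)
    also have "\<dots> \<le> card (word_ball G S (L * (d * n)))"
      by (intro card_mono finite_word_ball S sub)
    also have "\<dots> = card (word_ball G S (D * n))" by (simp add: D_def mult.assoc)
    also have "\<dots> \<le> card (word_ball G S n) ^ D"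
      by (rule card_word_ball_mult_le[OF S(2,1)])
    finally show ?thesis .
  qed
  \<comment> \<open>The ball of radius 0 is a point, so \<open>D = 0\<close> would give \<open>2 \<le> 1\<close> for \<open>n = 1\<close>.\<close>
  have D: "D > 0" using le[of 1] by (cases D) auto
  show "\<exists>c::real. c > 1 \<and> (\<forall>n. c ^ n \<le> real (card (word_ball G S n)))"
  proof (intro exI conjI allI)
    show "root D 2 > 1" using D by simp
    fix n
    have "(root D 2 ^ n) ^ D = (root D 2 ^ D) ^ n" by (simp add: power_mult[symmetric] mult.commute)
    also have "\<dots> = 2 ^ n" using D by simp
    also have "\<dots> \<le> real (card (word_ball G S n)) ^ D"
      using le[of n] by (metis of_nat_le_iff of_nat_numeral of_nat_power)
    finally show "root D 2 ^ n \<le> real (card (word_ball G S n))"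
      using D power_mono_iff[of "root D 2 ^ n" "real (card (word_ball G S n))" D] by simp
  qed
qed

lemma two_power_le_card_word_ball:
  fixes h :: "bool list \<Rightarrow> 'a"
  assumes "finite T" "inj_on h {es. length es = k}"
    and "\<And>es. length es = k \<Longrightarrow> h es \<in> word_ball G T n"
  shows "2 ^ k \<le> card (word_ball G T n)"
proof -
  have "card {es :: bool list. length es = k} = 2 ^ k"
    using card_lists_length_eq[of "UNIV :: bool set" k] by simp
  then show ?thesis
    using card_inj_on_le[OF assms(2) _ finite_word_ball[OF assms(1)]] assms(3) by auto
qed

end

lemma finite_generating_set_subgroup_generated:
  assumes "group G" "finite S" "S \<subseteq> carrier G"
  shows "finite_generating_set (subgroup_generated G S) S"
proof -
  interpret group G by fact
  let ?H = "subgroup_generated G S"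
  have S: "S \<subseteq> carrier ?H" using assms(3) by (rule subgroup_generated_subset_carrier_subset)
  have "generate ?H S = carrier (subgroup_generated ?H S)"
    using S by (simp only: carrier_subgroup_generated Int_absorb1)
  then show ?thesis using S assms(2) by (simp add: finite_generating_set_def)
qed

section \<open>The bubble group\<close>

locale bubble =
  fixes a b :: "nat \<Rightarrow> nat"
  assumes a_ge: "\<And>i. a i \<ge> 1" and b_ge: "\<And>i. b i \<ge> 3"
begin

abbreviation "V \<equiv> bubble_vertices a b"
abbreviation "G \<equiv> bubble_group a b"
abbreviation "\<alpha> \<equiv> bubble_alpha a b"
abbreviation "\<beta> \<equiv> bubble_beta a b"

lemma a_pos: "0 < a i" "a i \<noteq> 0"
  using a_ge[of i] by auto

lemma generators_Bij: "{\<alpha>, \<beta>} \<subseteq> carrier (BijGroup V)"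
proof -
  have "b i \<ge> 2" for i using b_ge[of i] by simp
  then show ?thesis
    using bubble_alpha_Bij[of a b] bubble_beta_Bij[of a b] a_ge by (simp add: BijGroup_def)
qed

sublocale group G
  unfolding bubble_group_def by (intro group.group_subgroup_generated group_BijGroup)

lemma generating_set: "finite_generating_set G {\<alpha>, \<beta>}"
  unfolding bubble_group_def
  by (intro finite_generating_set_subgroup_generated group_BijGroup generators_Bij) simp

lemma generators_closed: "\<alpha> \<in> carrier G" "\<beta> \<in> carrier G"
  using generating_set by (auto simp: finite_generating_set_def)

lemma carrier_Bij: "x \<in> carrier G \<Longrightarrow> x \<in> Bij V"
  using group.carrier_subgroup_generated_subset[OF group_BijGroup, of V "{\<alpha>, \<beta>}"]
  by (auto simp: bubble_group_def BijGroup_def)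

lemma mult_apply:
  "x \<in> carrier G \<Longrightarrow> y \<in> carrier G \<Longrightarrow> v \<in> V \<Longrightarrow> (x \<otimes>\<^bsub>G\<^esub> y) v = x (y v)"
  using carrier_Bij[of x] carrier_Bij[of y]
  by (simp add: bubble_group_def BijGroup_def compose_def)

lemma one_apply: "v \<in> V \<Longrightarrow> \<one>\<^bsub>G\<^esub> v = v"
  by (simp add: bubble_group_def BijGroup_def)

lemma alpha_apply: "(w, u) \<in> V \<Longrightarrow> \<alpha> (w, u) = (w, (u + 1) mod (2 * a (length w)))"
  by (simp add: bubble_alpha_def)

lemma alpha_pow_apply:
  assumes "w \<in> bubble_words b" "n \<le> a (length w)"
  shows "(\<alpha> [^]\<^bsub>G\<^esub> n) (w, 0) = (w, n)"
  using assms(2)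
proof (induction n)
  case 0
  then show ?case using assms(1) a_pos by (simp add: one_apply bubble_vertices_def)
next
  case (Suc n)
  have V: "(w, n) \<in> V" "(w, 0) \<in> V" using assms(1) Suc.prems a_pos by (auto simp: bubble_vertices_def)
  have "\<alpha> [^]\<^bsub>G\<^esub> Suc n = \<alpha> \<otimes>\<^bsub>G\<^esub> \<alpha> [^]\<^bsub>G\<^esub> n"
    using nat_pow_Suc2 generators_closed by blast
  then show ?case
    using Suc V generators_closed by (simp add: mult_apply alpha_apply)
qed

lemma beta_interior:
  assumes "w \<in> bubble_words b" "0 < u" "u < a (length w)"
  shows "\<beta> (w, u) = (w, u)"
  using assms by (simp add: bubble_beta_def bubble_vertices_def)

lemma beta_far_point:
  assumes "w \<in> bubble_words b"
  shows "\<beta> (w, a (length w)) = (w @ [1], 0)"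
  using assms a_pos[of "length w"] by (simp add: bubble_beta_def bubble_vertices_def)

lemma beta_first_child:
  assumes "w \<in> bubble_words b"
  shows "\<beta> (w @ [1], 0) = (w @ [2], 0)"
  using assms a_pos[of "Suc (length w)"] b_ge[of "length w"]
  by (simp add: bubble_beta_def bubble_vertices_def words_snoc)

lemma children_words:
  assumes "w \<in> bubble_words b"
  shows "w @ [1] \<in> bubble_words b" "w @ [2] \<in> bubble_words b"
  using assms b_ge[of "length w"] by (auto simp: words_snoc)

section \<open>Bubbles of unbounded length\<close>

text \<open>The product of the factors \<open>\<alpha>\<close> and \<open>\<beta>\<alpha>\<close> chosen by the entries. Permutations compose from right
  to left, so the head of the list, which stands rightmost, acts first.\<close>

fun itinerary :: "bool list \<Rightarrow> vertex \<Rightarrow> vertex" where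
  "itinerary [] = \<one>\<^bsub>G\<^esub>"
| "itinerary (e # es) = itinerary es \<otimes>\<^bsub>G\<^esub> (if e then \<beta> \<otimes>\<^bsub>G\<^esub> \<alpha> else \<alpha>)"

lemma itinerary_closed: "itinerary es \<in> carrier G"
  by (induction es) (auto simp: generators_closed)

lemma itinerary_in_word_ball: "itinerary es \<in> word_ball G {\<alpha>, \<beta>} (2 * length es)"
proof (induction es)
  case (Cons e es)
  have T: "{\<alpha>, \<beta>} \<subseteq> carrier G" by (simp add: generators_closed)
  have 1: "\<alpha> \<in> word_ball G {\<alpha>, \<beta>} 1" "\<beta> \<in> word_ball G {\<alpha>, \<beta>} 1" "\<alpha> \<in> word_ball G {\<alpha>, \<beta>} 2"
    using T by (auto intro: generator_in_word_ball)
  have "(if e then \<beta> \<otimes>\<^bsub>G\<^esub> \<alpha> else \<alpha>) \<in> word_ball G {\<alpha>, \<beta>} 2"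
    using word_ball_mult[OF T 1(2,1)] 1(3) by (simp add: numeral_2_eq_2)
  then have "itinerary (e # es) \<in> word_ball G {\<alpha>, \<beta>} (2 * length es + 2)"
    unfolding itinerary.simps by (rule word_ball_mult[OF T Cons])
  then show ?case by simp
qed (simp add: one_in_word_ball)

text \<open>Both factors \<open>\<alpha>\<close> and \<open>\<beta>\<alpha>\<close> advance by one step as long as the far point of the bubble is not
  reached: in between, \<open>\<beta>\<close> does nothing.\<close>

lemma itinerary_apply:
  assumes "w \<in> bubble_words b" "u + length es < a (length w)"
  shows "itinerary es (w, u) = (w, u + length es)"
  using assms(2)
proof (induction es arbitrary: u)
  case Nil
  then show ?case using assms(1) by (simp add: one_apply bubble_vertices_def)
next
  case (Cons e es)
  have "(w, u) \<in> V" "\<alpha> (w, u) = (w, Suc u)" "\<beta> (w, Suc u) = (w, Suc u)"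
    using assms(1) Cons.prems
    by (simp_all add: alpha_apply bubble_vertices_def beta_interior)
  then have "itinerary (e # es) (w, u) = itinerary es (w, Suc u)"
    by (simp add: mult_apply generators_closed itinerary_closed)
  then show ?case using Cons by simp
qed

text \<open>The test vertex is the last one of the bubble \<open>w @ [1]\<close>. The factor \<open>\<alpha>\<close> brings it to the start of
  that bubble and \<open>\<beta>\<alpha>\<close> to the start of the neighbour \<open>w @ [2]\<close>; the remaining factors keep it
  inside, so the final bubble remembers the first factor.\<close>

lemma itinerary_distinct:
  assumes w: "w \<in> bubble_words b"
    and len: "length es < a (Suc (length w))" "length fs < a (Suc (length w))"
  shows "itinerary (False # es) \<noteq> itinerary (True # fs)"
proof -
  let ?v = "(w @ [1], 2 * a (Suc (length w)) - 1)"
  have V: "?v \<in> V" and \<alpha>: "\<alpha> ?v = (w @ [1], 0)"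
    using children_words[OF w] a_pos[of "Suc (length w)"]
    by (simp_all add: alpha_apply bubble_vertices_def)
  have "itinerary (False # es) ?v = (w @ [1], length es)"
    using V \<alpha> itinerary_apply[OF children_words(1)[OF w], of 0 es] len
    by (simp add: mult_apply generators_closed itinerary_closed)
  moreover have "itinerary (True # fs) ?v = (w @ [2], length fs)"
    using V \<alpha> itinerary_apply[OF children_words(2)[OF w], of 0 fs] len beta_first_child[OF w]
    by (simp add: mult_apply generators_closed itinerary_closed)
  ultimately show ?thesis by auto
qed

lemma inj_itinerary:
  assumes unbounded: "\<And>A. \<exists>m. a m > A"
  shows "length es = length fs \<Longrightarrow> itinerary es = itinerary fs \<Longrightarrow> es = fs"
proof (induction es fs rule: list_induct2)
  case (Cons e es f fs)
  \<comment> \<open>\<open>itinerary_distinct\<close> concerns a bubble with a parent, at a level \<open>m > 0\<close>; \<open>a m > a 0\<close> ensures this.\<close>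
  obtain m where m: "a m > max (length es) (a 0)" using unbounded by blast
  then obtain l where l: "m = Suc l" by (cases m) auto
  have "1 < b i" for i using b_ge[of i] by simp
  then have w: "replicate l 1 \<in> bubble_words b" by (simp add: bubble_words_def)
  have "e = f"
    using itinerary_distinct[OF w, of es fs] itinerary_distinct[OF w, of fs es]
      Cons.prems Cons.hyps m l by (cases e; cases f) auto
  moreover from this have "itinerary es = itinerary fs"
    using Cons.prems itinerary_closed generators_closed by (auto split: if_splits)
  ultimately show ?case using Cons.IH by simp
qed simp

lemma exponential_growth_if_unbounded:
  assumes "\<And>A. \<exists>m. a m > A"
  shows "exponential_growth G"
proof (rule exponential_growthI[OF generating_set])
  show "2 ^ k \<le> card (word_ball G {\<alpha>, \<beta>} (2 * k))" for k
    using itinerary_in_word_ball inj_itinerary[OF assms]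
    by (intro two_power_le_card_word_ball[where h = itinerary]) (auto intro!: inj_onI)
qed

section \<open>Bubbles of bounded length\<close>

text \<open>The tail of the list acts first and leads to a bubble at level \<open>length es\<close>; the head then chooses
  the child by which the path continues. The power of \<open>\<alpha>\<close> is the distance from the start of that
  bubble to its far point.\<close>

fun descent :: "bool list \<Rightarrow> vertex \<Rightarrow> vertex" where
  "descent [] = \<one>\<^bsub>G\<^esub>"
| "descent (e # es) = (if e then \<beta> \<otimes>\<^bsub>G\<^esub> \<beta> else \<beta>) \<otimes>\<^bsub>G\<^esub> (\<alpha> [^]\<^bsub>G\<^esub> a (length es) \<otimes>\<^bsub>G\<^esub> descent es)"

lemma descent_closed: "descent es \<in> carrier G"
  by (induction es) (auto simp: generators_closed)

lemma descent_in_word_ball: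
  assumes "\<And>m. a m \<le> A"
  shows "descent es \<in> word_ball G {\<alpha>, \<beta>} ((A + 2) * length es)"
proof (induction es)
  case (Cons e es)
  have T: "{\<alpha>, \<beta>} \<subseteq> carrier G" by (simp add: generators_closed)
  have 1: "\<alpha> \<in> word_ball G {\<alpha>, \<beta>} 1" "\<beta> \<in> word_ball G {\<alpha>, \<beta>} 1" "\<beta> \<in> word_ball G {\<alpha>, \<beta>} 2"
    using T by (auto intro: generator_in_word_ball)
  have \<beta>: "(if e then \<beta> \<otimes>\<^bsub>G\<^esub> \<beta> else \<beta>) \<in> word_ball G {\<alpha>, \<beta>} 2"
    using word_ball_mult[OF T 1(2,2)] 1(3) by (simp add: numeral_2_eq_2)
  have "\<alpha> [^]\<^bsub>G\<^esub> a (length es) \<in> word_ball G {\<alpha>, \<beta>} A"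
    using word_ball_pow[OF T 1(1), of "a (length es)"] assms[of "length es"]
      word_ball_mono[of "a (length es)" A G] by auto
  then show ?case
    using word_ball_mult[OF T \<beta> word_ball_mult[OF T _ Cons]] by (simp add: algebra_simps)
qed (simp add: one_in_word_ball)

lemma descent_apply:
  "rev (map (\<lambda>e. if e then 2 else 1) es) \<in> bubble_words b \<and>
   descent es ([], 0) = (rev (map (\<lambda>e. if e then 2 else 1) es), 0)"
proof (induction es)
  case Nil
  then show ?case by (simp add: one_apply bubble_vertices_def bubble_words_def a_pos)
next
  case (Cons e es)
  define w :: "nat list" where "w = rev (map (\<lambda>e. if e then 2 else 1) es)"
  have w: "w \<in> bubble_words b" "descent es ([], 0) = (w, 0)" "length w = length es"
    using Cons by (auto simp: w_def)
  have V: "([], 0) \<in> V" "(w, 0) \<in> V" "(w, a (length es)) \<in> V"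
    using w a_pos by (auto simp: bubble_vertices_def bubble_words_def)
  have "(\<alpha> [^]\<^bsub>G\<^esub> a (length es) \<otimes>\<^bsub>G\<^esub> descent es) ([], 0) = (w, a (length w))"
    using V w alpha_pow_apply[OF w(1), of "a (length es)"]
    by (simp add: mult_apply generators_closed descent_closed)
  then have "descent (e # es) ([], 0) = (w @ [if e then 2 else 1], 0)"
    using V w beta_far_point[OF w(1)] beta_first_child[OF w(1)]
    by (simp add: mult_apply generators_closed descent_closed)
  then show ?case using children_words[OF w(1)] by (simp add: w_def)
qed

lemma inj_descent: "inj descent"
proof (rule injI)
  fix es fs assume "descent es = descent fs"
  then have "map (\<lambda>e. if e then 2 else 1) es = map (\<lambda>e. if e then 2 else (1::nat)) fs"
    using descent_apply[of es] descent_apply[of fs] by (metis prod.inject rev_rev_ident)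
  moreover have "inj (\<lambda>e. if e then 2 else (1::nat))" by (auto simp: inj_def)
  ultimately show "es = fs" by (simp add: inj_map_eq_map)
qed

lemma exponential_growth_if_bounded:
  assumes "\<And>m. a m \<le> A"
  shows "exponential_growth G"
proof (rule exponential_growthI[OF generating_set])
  show "2 ^ k \<le> card (word_ball G {\<alpha>, \<beta>} ((A + 2) * k))" for k
    using descent_in_word_ball[OF assms] inj_on_subset[OF inj_descent]
    by (intro two_power_le_card_word_ball[where h = descent]) auto
qed

end

theorem lemma5p1:
  fixes a b :: "nat \<Rightarrow> nat"
  assumes "\<And>i. a i \<ge> 1" and "\<And>i. b i \<ge> 3"
  shows "exponential_growth (bubble_group a b)"
proof -
  interpret bubble a b by unfold_locales (fact assms)+
  show ?thesis
  proof (cases "\<exists>A. \<forall>m. a m \<le> A")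
    case True
    then show ?thesis using exponential_growth_if_bounded by blast
  next
    case False
    then show ?thesis using exponential_growth_if_unbounded by (meson not_le)
  qed
qed

end
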